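(* Let $d\ge 1$, $m\ge 1$, let $Q\subset\mathbb{R}^d$ be a hyperbox or a finite set of points, let $f:Q\to\mathbb{R}$ be continuous, let $L$ be a real polynomial in $d$ variables of degree at most $m$, and let $E^+,E^-\subset Q$ be the sets of points of maximal positive and maximal negative deviation of $L$ from $f$. Then $$\mathrm{co}\{\mathbf{M}^m(\mathbf{x}):\mathbf{x}\in E^+\}\cap \mathrm{co}\{\mathbf{M}^m(\mathbf{x}):\mathbf{x}\in E^-\}\neq\emptyset$$ if and only if for every $(\mathbf{u},a)\in\mathbb{R}^d\times\mathbb{R}$ at least one of the following two conditions holds: 1. (polynomial degree reduction) $\ \mathrm{co}\{\mathbf{M}^{m-1}(\mathbf{x}):\mathbf{x}\in E^+(\mathbf{u},a)\}\cap \mathrm{co}\{\mathbf{M}^{m-1}(\mathbf{x}):\mathbf{x}\in E^-(\mathbf{u},a)\}\neq\emptyset$; 2. (point elimination) $\ \mathrm{co}\{\mathbf{M}^{m}(\mathbf{x}):\mathbf{x}\in E_0^+(\mathbf{u},a)\}\cap \mathrm{co}\{\mathbf{M}^{m}(\mathbf{x}):\mathbf{x}\in E_0^-(\mathbf{u},a)\}\neq\emptyset$.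
   Context: $\mathrm{co}$ denotes the convex hull (the convex hull of the empty set is empty). A hyperbox is a set $\{\mathbf{x}\in\mathbb{R}^d: p_i\le x_i\le q_i,\ i=1,\dots,d\}$. For an integer $k\ge 0$, $\mathbf{M}^k(\mathbf{x})$ is the vector whose components are all monomials $\mathbf{x}^{\mathbf{e}}=x_1^{e_1}\cdots x_d^{e_d}$ with exponents $\mathbf{e}\in\mathbb{N}^d$ ($0\in\mathbb{N}$), $|\mathbf{e}|=e_1+\dots+e_d\le k$. Extreme points: $$E^+=\{\mathbf{x}\in Q: L(\mathbf{x})-f(\mathbf{x})=\max_{\mathbf{y}\in Q}|f(\mathbf{y})-L(\mathbf{y})|\},\qquad E^-=\{\mathbf{x}\in Q: f(\mathbf{x})-L(\mathbf{x})=\max_{\mathbf{y}\in Q}|f(\mathbf{y})-L(\mathbf{y})|\}.$$ For $(\mathbf{u},a)\in\mathbb{R}^d\times\mathbb{R}$ put $\mathscr{H}(\mathbf{u},a)=\{\mathbf{x}\in\mathbb{R}^d:\langle\mathbf{u},\mathbf{x}\rangle-a=0\}$, $\mathscr{H}^+(\mathbf{u},a)=\{\mathbf{x}\in\mathbb{R}^d:\langle\mathbf{u},\mathbf{x}\rangle-a>0\}$, $\mathscr{H}^-(\mathbf{u},a)=\{\mathbf{x}\in\mathbb{R}^d:\langle\mathbf{u},\mathbf{x}\rangle-a<0\}$, and - $E^+(\mathbf{u},a)=(E^+\cap\mathscr{H}^+(\mathbf{u},a))\cup(E^-\cap\mathscr{H}^-(\mathbf{u},a))$, - $E^-(\mathbf{u},a)=(E^-\cap\mathscr{H}^+(\mathbf{u},a))\cup(E^+\cap\mathscr{H}^-(\mathbf{u},a))$,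 - $E_0^+(\mathbf{u},a)=E^+\cap\mathscr{H}(\mathbf{u},a)$, - $E_0^-(\mathbf{u},a)=E^-\cap\mathscr{H}(\mathbf{u},a)$. *)

theory Defs
  imports "HOL-Analysis.Analysis" "HOL-Analysis.Finite_Function_Topology"
begin

definition total_degree :: "nat ^ 'd \<Rightarrow> nat" where
  "total_degree e = (\<Sum>i\<in>UNIV. e $ i)"

definition monomial :: "nat ^ 'd \<Rightarrow> real ^ 'd \<Rightarrow> real" where
  "monomial e x = (\<Prod>i\<in>UNIV. (x $ i) ^ (e $ i))"

definition polynomial_of_degree_le :: "nat \<Rightarrow> (real ^ 'd \<Rightarrow> real) \<Rightarrow> bool" where
  "polynomial_of_degree_le m L \<longleftrightarrow>
     (\<exists>c. \<forall>x. L x = (\<Sum>e | total_degree e \<le> m. c e * monomial e x))"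

text \<open>
  The length of the vector \<open>M\<^sup>k(x)\<close> depends on the number \<open>k\<close>, so it cannot be the index type of
  a \<open>vec\<close>. Instead it is a finitely supported family indexed by all exponents, with the
  entries of total degree above \<open>k\<close> equal to zero; this identifies the space of vectors indexed
  by the exponents of total degree at most \<open>k\<close> with a linear subspace of the real vector
  space \<open>nat ^ 'd \<Rightarrow>\<^sub>0 real\<close>.
\<close>

definition monomial_vector :: "nat \<Rightarrow> real ^ 'd \<Rightarrow> (nat ^ 'd \<Rightarrow>\<^sub>0 real)" where
  "monomial_vector k x = (\<Sum>e | total_degree e \<le> k. Poly_Mapping.single e (monomial e x))"

lemma finite_total_degree_le: "finite {e :: nat ^ 'd. total_degree e \<le> k}"
proof -
  have "{e :: nat ^ 'd. total_degree e \<le> k} \<subseteq> vec_lambda ` (UNIV \<rightarrow>\<^sub>E {..k})"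
  proof
    fix e :: "nat ^ 'd"
    assume e: "e \<in> {e. total_degree e \<le> k}"
    have "e $ i \<le> total_degree e" for i
      unfolding total_degree_def by (rule member_le_sum) auto
    with e have "vec_nth e \<in> UNIV \<rightarrow>\<^sub>E {..k}"
      by (auto intro: order_trans)
    then show "e \<in> vec_lambda ` (UNIV \<rightarrow>\<^sub>E {..k})"
      by (metis image_eqI vec_nth_inverse)
  qed
  moreover have "finite (UNIV \<rightarrow>\<^sub>E {..k} :: ('d \<Rightarrow> nat) set)"
    by (intro finite_PiE) auto
  ultimately show ?thesis
    by (meson finite_imageI finite_subset)
qed

lemma lookup_monomial_vector:
  "Poly_Mapping.lookup (monomial_vector k x) e = (if total_degree e \<le> k then monomial e x else 0)"
  by (simp add: monomial_vector_def lookup_sum lookup_single when_def finite_total_degree_le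
      if_distrib sum.delta)

text \<open>
  For nonempty compact \<open>Q\<close> and continuous \<open>f\<close> and \<open>L\<close> the supremum is attained, i.e.
  it is the maximum. (\<open>Max\<close> is unsuitable, as it is specified for finite sets only.)
\<close>

definition max_deviation :: "(real ^ 'd) set \<Rightarrow> (real ^ 'd \<Rightarrow> real) \<Rightarrow> (real ^ 'd \<Rightarrow> real) \<Rightarrow> real" where
  "max_deviation Q f L = (SUP y\<in>Q. \<bar>f y - L y\<bar>)"

lemma max_deviation_attained:
  assumes "compact Q" "Q \<noteq> {}" "continuous_on Q f" "continuous_on Q L"
  shows "\<exists>x\<in>Q. \<bar>f x - L x\<bar> = max_deviation Q f L \<and> (\<forall>y\<in>Q. \<bar>f y - L y\<bar> \<le> \<bar>f x - L x\<bar>)"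
proof -
  have "continuous_on Q (\<lambda>y. \<bar>f y - L y\<bar>)"
    using assms by (intro continuous_intros)
  then obtain x where x: "x \<in> Q" "\<forall>y\<in>Q. \<bar>f y - L y\<bar> \<le> \<bar>f x - L x\<bar>"
    using continuous_attains_sup[OF assms(1,2)] by blast
  then have "max_deviation Q f L = \<bar>f x - L x\<bar>"
    unfolding max_deviation_def by (intro cSup_eq_maximum) auto
  with x show ?thesis by auto
qed

definition E_plus :: "(real ^ 'd) set \<Rightarrow> (real ^ 'd \<Rightarrow> real) \<Rightarrow> (real ^ 'd \<Rightarrow> real) \<Rightarrow> (real ^ 'd) set" where
  "E_plus Q f L = {x \<in> Q. L x - f x = max_deviation Q f L}"

definition E_minus :: "(real ^ 'd) set \<Rightarrow> (real ^ 'd \<Rightarrow> real) \<Rightarrow> (real ^ 'd \<Rightarrow> real) \<Rightarrow> (real ^ 'd) set" where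
  "E_minus Q f L = {x \<in> Q. f x - L x = max_deviation Q f L}"

text \<open>
  The case \<open>u = 0\<close> is included in the following three sets, so that each of them may be
  empty or the whole space.
\<close>

definition H_zero :: "real ^ 'd \<Rightarrow> real \<Rightarrow> (real ^ 'd) set" where
  "H_zero u a = {x. u \<bullet> x - a = 0}"

definition H_plus :: "real ^ 'd \<Rightarrow> real \<Rightarrow> (real ^ 'd) set" where
  "H_plus u a = {x. u \<bullet> x - a > 0}"

definition H_minus :: "real ^ 'd \<Rightarrow> real \<Rightarrow> (real ^ 'd) set" where
  "H_minus u a = {x. u \<bullet> x - a < 0}"

text \<open>
  In the following sets \<open>Ep\<close> and \<open>Em\<close> stand for the sets of points of maximal positive
  and maximal negative deviation.
\<close>

definition E_plus_split ::
    "(real ^ 'd) set \<Rightarrow> (real ^ 'd) set \<Rightarrow> real ^ 'd \<Rightarrow> real \<Rightarrow> (real ^ 'd) set" where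
  "E_plus_split Ep Em u a = (Ep \<inter> H_plus u a) \<union> (Em \<inter> H_minus u a)"

definition E_minus_split ::
    "(real ^ 'd) set \<Rightarrow> (real ^ 'd) set \<Rightarrow> real ^ 'd \<Rightarrow> real \<Rightarrow> (real ^ 'd) set" where
  "E_minus_split Ep Em u a = (Em \<inter> H_plus u a) \<union> (Ep \<inter> H_minus u a)"

end

theory Submission
  imports Defs
begin

text \<open>
  A common point of the convex hulls of \<open>M\<^sup>k(S)\<close> and \<open>M\<^sup>k(T)\<close> amounts to two nonzero,
  finitely supported, nonnegative weights on \<open>S\<close> and on \<open>T\<close> that give the same value to every
  polynomial of degree at most \<open>k\<close> (\<open>convex_hulls_meet_iff_equal_moments\<close>): the weights of two
  convex combinations certainly have this property, and conversely equal moments include equal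
  total masses, so that both weights can be normalised by the same factor.

  Suppose that weights \<open>\<alpha>\<close> on \<open>E\<^sup>+\<close> and \<open>\<beta>\<close> on \<open>E\<^sup>-\<close> agree up to degree \<open>m\<close>, and let
  \<open>l(x) = \<langle>u, x\<rangle> - a\<close>. Then \<open>\<alpha> l\<close> and \<open>\<beta> l\<close> agree up to degree \<open>m - 1\<close>, because \<open>l q\<close> has degree
  at most \<open>m\<close> whenever \<open>q\<close> has degree at most \<open>m - 1\<close>. These weights are negative where \<open>l < 0\<close>;
  moving the negative parts to the other side of the equation exchanges the two signs of
  deviation there and turns \<open>l\<close> into \<open>\<bar>l\<bar>\<close>, which yields nonnegative weights on \<open>E\<^sup>+(u,a)\<close> and
  \<open>E\<^sup>-(u,a)\<close>. If they do not vanish, this is degree reduction. If they do, then \<open>\<alpha>\<close> and \<open>\<beta>\<close> are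
  concentrated on the hyperplane, and this is point elimination.

  The converse implication is the degenerate choice \<open>u = 0\<close>, \<open>a = 0\<close>, for which the hyperplane is
  the whole space: degree reduction is impossible and point elimination is the claim.
\<close>

section \<open>Polynomial moments and convex hulls of monomial vectors\<close>

lemma convex_hull_image_explicit:
  fixes g :: "'a \<Rightarrow> 'b :: real_vector"
  assumes "y \<in> convex hull (g ` S)"
  shows "\<exists>A w. finite A \<and> A \<subseteq> S \<and> (\<forall>x\<in>A. 0 \<le> w x) \<and> sum w A = (1 :: real)
    \<and> (\<Sum>x\<in>A. w x *\<^sub>R g x) = y"
proof -
  obtain F w where F: "finite F" "F \<subseteq> g ` S" "\<forall>v\<in>F. 0 \<le> w v" "sum w F = (1 :: real)"
    "(\<Sum>v\<in>F. w v *\<^sub>R v) = y"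
    using assms unfolding convex_hull_explicit by blast
  \<comment> \<open>As \<open>g\<close> need not be injective, one preimage is chosen for each point of the combination.\<close>
  obtain A where A: "A \<subseteq> S" "inj_on g A" "F = g ` A"
    using F(2) by (meson subset_image_inj)
  show ?thesis
    using F A by (intro exI[of _ A] exI[of _ "w \<circ> g"])
      (auto simp: sum.reindex finite_image_iff o_def)
qed

lemma monomial_zero [simp]: "monomial 0 x = 1"
  by (simp add: monomial_def)

lemma total_degree_zero [simp]: "total_degree 0 = 0"
  by (simp add: total_degree_def)

lemma total_degree_add_axis: "total_degree (e + axis i 1) = Suc (total_degree e)"
  by (simp add: total_degree_def sum.distrib axis_def)

lemma monomial_add_axis: "monomial (e + axis i 1) x = x $ i * monomial e x"
proof -
  have "(\<Prod>j\<in>UNIV. (x $ j) ^ (axis i 1 $ j)) = (\<Prod>j\<in>UNIV. if j = i then x $ j else 1)"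
    by (rule prod.cong) (auto simp: axis_def)
  then show ?thesis
    by (simp add: monomial_def power_add prod.distrib)
qed

lemma affine_times_monomial:
  "(u \<bullet> x - a) * monomial e x = (\<Sum>i\<in>UNIV. u $ i * monomial (e + axis i 1) x) - a * monomial e x"
  by (simp add: inner_vec_def monomial_add_axis algebra_simps sum_distrib_left del: One_nat_def)

definition equal_moments ::
    "nat \<Rightarrow> (real ^ 'd) set \<Rightarrow> (real ^ 'd \<Rightarrow> real) \<Rightarrow> (real ^ 'd) set \<Rightarrow> (real ^ 'd \<Rightarrow> real) \<Rightarrow> bool" where
  "equal_moments k A \<alpha> B \<beta> \<longleftrightarrow>
     (\<forall>e. total_degree e \<le> k \<longrightarrow>
        (\<Sum>x\<in>A. \<alpha> x * monomial e x) = (\<Sum>x\<in>B. \<beta> x * monomial e x))"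

lemma equal_moments_imp_equal_mass:
  assumes "equal_moments k A \<alpha> B \<beta>"
  shows "sum \<alpha> A = sum \<beta> B"
  using assms unfolding equal_moments_def by (auto dest: spec[of _ 0])

lemma lookup_scaleR: "Poly_Mapping.lookup (c *\<^sub>R p) e = c * Poly_Mapping.lookup p e"
proof -
  have "finite {e. c * Poly_Mapping.lookup p e \<noteq> 0}"
    by (rule finite_subset[OF _ finite_lookup[of p]]) auto
  then show ?thesis
    by (simp add: scaleR_poly_mapping_def Abs_poly_mapping_inverse)
qed

lemma equal_moments_iff_equal_combinations:
  "equal_moments k A \<alpha> B \<beta> \<longleftrightarrow>
     (\<Sum>x\<in>A. \<alpha> x *\<^sub>R monomial_vector k x) = (\<Sum>x\<in>B. \<beta> x *\<^sub>R monomial_vector k x)"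
proof -
  have "Poly_Mapping.lookup (\<Sum>x\<in>C. \<gamma> x *\<^sub>R monomial_vector k x) e =
      (if total_degree e \<le> k then \<Sum>x\<in>C. \<gamma> x * monomial e x else 0)"
    for C and \<gamma> :: "real ^ 'a \<Rightarrow> real" and e
    by (simp add: lookup_sum lookup_monomial_vector lookup_scaleR)
  then show ?thesis
    by (auto simp: equal_moments_def poly_mapping_eq_iff fun_eq_iff)
qed

lemma convex_hulls_meet_iff_equal_moments:
  "convex hull (monomial_vector k ` S) \<inter> convex hull (monomial_vector k ` T) \<noteq> {} \<longleftrightarrow>
     (\<exists>A \<alpha> B \<beta>. finite A \<and> A \<subseteq> S \<and> finite B \<and> B \<subseteq> T \<and>
        (\<forall>x\<in>A. 0 \<le> \<alpha> x) \<and> (\<forall>x\<in>B. 0 \<le> \<beta> x) \<and> 0 < sum \<alpha> A \<and> equal_moments k A \<alpha> B \<beta>)"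
    (is "?meet \<longleftrightarrow> ?weights")
proof
  assume ?meet
  then obtain y where y: "y \<in> convex hull (monomial_vector k ` S)"
    "y \<in> convex hull (monomial_vector k ` T)"
    by blast
  obtain A \<alpha> where A: "finite A" "A \<subseteq> S" "\<forall>x\<in>A. 0 \<le> \<alpha> x" "sum \<alpha> A = 1"
    "(\<Sum>x\<in>A. \<alpha> x *\<^sub>R monomial_vector k x) = y"
    using convex_hull_image_explicit[OF y(1)] by blast
  obtain B \<beta> where B: "finite B" "B \<subseteq> T" "\<forall>x\<in>B. 0 \<le> \<beta> x"
    "(\<Sum>x\<in>B. \<beta> x *\<^sub>R monomial_vector k x) = y"
    using convex_hull_image_explicit[OF y(2)] by blast
  have "equal_moments k A \<alpha> B \<beta>"
    unfolding equal_moments_iff_equal_combinations A(5) B(4) ..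
  moreover have "0 < sum \<alpha> A"
    using A(4) by simp
  ultimately show ?weights
    using A(1-3) B(1-3) by blast
next
  assume ?weights
  then obtain A \<alpha> B \<beta> where A: "finite A" "A \<subseteq> S" "\<forall>x\<in>A. 0 \<le> \<alpha> x" "0 < sum \<alpha> A"
    and B: "finite B" "B \<subseteq> T" "\<forall>x\<in>B. 0 \<le> \<beta> x" and eq: "equal_moments k A \<alpha> B \<beta>"
    by blast
  define c where "c = sum \<alpha> A"
  have c: "c > 0" "sum \<alpha> A = c" "sum \<beta> B = c"
    using A equal_moments_imp_equal_mass[OF eq] by (auto simp: c_def)
  let ?y = "(1 / c) *\<^sub>R (\<Sum>x\<in>A. \<alpha> x *\<^sub>R monomial_vector k x)"
  have in_hull: "(1 / c) *\<^sub>R (\<Sum>x\<in>C. \<gamma> x *\<^sub>R monomial_vector k x) \<in> convex hull (monomial_vector k ` U)"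
    if "finite C" "C \<subseteq> U" "\<forall>x\<in>C. 0 \<le> \<gamma> x" "sum \<gamma> C = c" for C U \<gamma>
  proof -
    have "(\<Sum>x\<in>C. (\<gamma> x / c) *\<^sub>R monomial_vector k x) \<in> convex hull (monomial_vector k ` U)"
      using that c(1) by (intro convex_sum convex_convex_hull hull_inc)
        (auto simp flip: sum_divide_distrib)
    then show ?thesis
      by (simp add: scaleR_sum_right)
  qed
  have "?y \<in> convex hull (monomial_vector k ` S)"
    by (rule in_hull) (use A c in auto)
  moreover have "?y \<in> convex hull (monomial_vector k ` T)"
    unfolding eq[unfolded equal_moments_iff_equal_combinations]
    by (rule in_hull) (use B c in auto)
  ultimately show ?meet
    by blast
qed

section \<open>Reduction of the degree by an affine factor\<close>

text \<open>
  Multiplication by an affine form costs one degree: each of its terms raises the degree of a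
  monomial by at most one.
\<close>

lemma equal_moments_times_affine:
  assumes "equal_moments (Suc k) A \<alpha> B \<beta>"
  shows "equal_moments k A (\<lambda>x. \<alpha> x * (u \<bullet> x - a)) B (\<lambda>x. \<beta> x * (u \<bullet> x - a))"
  unfolding equal_moments_def
proof (intro allI impI)
  fix e :: "nat ^ 'a"
  assume e: "total_degree e \<le> k"
  have expand: "(\<Sum>x\<in>C. \<gamma> x * (u \<bullet> x - a) * monomial e x) =
      (\<Sum>i\<in>UNIV. u $ i * (\<Sum>x\<in>C. \<gamma> x * monomial (e + axis i 1) x)) - a * (\<Sum>x\<in>C. \<gamma> x * monomial e x)"
    for C and \<gamma> :: "real ^ 'a \<Rightarrow> real"
  proof -
    have "(\<Sum>x\<in>C. \<gamma> x * (u \<bullet> x - a) * monomial e x) =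
        (\<Sum>x\<in>C. \<gamma> x * ((\<Sum>i\<in>UNIV. u $ i * monomial (e + axis i 1) x) - a * monomial e x))"
      by (simp only: mult.assoc affine_times_monomial)
    also have "\<dots> = (\<Sum>x\<in>C. \<Sum>i\<in>UNIV. u $ i * (\<gamma> x * monomial (e + axis i 1) x))
        - (\<Sum>x\<in>C. a * (\<gamma> x * monomial e x))"
      by (simp add: right_diff_distrib sum_subtractf sum_distrib_left mult.left_commute)
    also have "\<dots> = (\<Sum>i\<in>UNIV. \<Sum>x\<in>C. u $ i * (\<gamma> x * monomial (e + axis i 1) x))
        - (\<Sum>x\<in>C. a * (\<gamma> x * monomial e x))"
      by (subst sum.swap) simp
    finally show ?thesis
      by (simp add: sum_distrib_left)
  qed
  have "(\<Sum>x\<in>A. \<alpha> x * monomial (e + axis i 1) x) = (\<Sum>x\<in>B. \<beta> x * monomial (e + axis i 1) x)" for i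
    using assms e by (simp add: equal_moments_def total_degree_add_axis del: One_nat_def)
  moreover have "(\<Sum>x\<in>A. \<alpha> x * monomial e x) = (\<Sum>x\<in>B. \<beta> x * monomial e x)"
    using assms e by (simp add: equal_moments_def)
  ultimately show "(\<Sum>x\<in>A. \<alpha> x * (u \<bullet> x - a) * monomial e x) =
      (\<Sum>x\<in>B. \<beta> x * (u \<bullet> x - a) * monomial e x)"
    unfolding expand by simp
qed

lemma sum_split_by_hyperplane:
  fixes g :: "real ^ 'd \<Rightarrow> real"
  assumes "finite C"
  shows "(\<Sum>x\<in>C. (u \<bullet> x - a) * g x) =
    (\<Sum>x\<in>C \<inter> H_plus u a. \<bar>u \<bullet> x - a\<bar> * g x) - (\<Sum>x\<in>C \<inter> H_minus u a. \<bar>u \<bullet> x - a\<bar> * g x)"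
proof -
  have "(\<Sum>x\<in>C \<inter> H_plus u a. \<bar>u \<bullet> x - a\<bar> * g x) - (\<Sum>x\<in>C \<inter> H_minus u a. \<bar>u \<bullet> x - a\<bar> * g x) =
      (\<Sum>x\<in>C. (if x \<in> H_plus u a then \<bar>u \<bullet> x - a\<bar> * g x else 0)
        - (if x \<in> H_minus u a then \<bar>u \<bullet> x - a\<bar> * g x else 0))"
    using assms by (simp add: sum.inter_restrict sum_subtractf)
  also have "\<dots> = (\<Sum>x\<in>C. (u \<bullet> x - a) * g x)"
    by (rule sum.cong) (auto simp: H_plus_def H_minus_def abs_if algebra_simps)
  finally show ?thesis ..
qed

text \<open>
  The weight that remains on one of the two split sets. It is well defined even for overlapping
  \<open>E\<^sup>+\<close> and \<open>E\<^sup>-\<close>, because the two pieces of a split set lie in disjoint half-spaces.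
\<close>

definition split_weight ::
    "(real ^ 'd \<Rightarrow> real) \<Rightarrow> (real ^ 'd \<Rightarrow> real) \<Rightarrow> real ^ 'd \<Rightarrow> real \<Rightarrow> real ^ 'd \<Rightarrow> real" where
  "split_weight \<alpha> \<beta> u a x = (if x \<in> H_plus u a then \<alpha> x else \<beta> x) * \<bar>u \<bullet> x - a\<bar>"

lemma E_minus_split_swap: "E_minus_split Ep Em u a = E_plus_split Em Ep u a"
  by (simp add: E_minus_split_def E_plus_split_def)

lemma finite_E_plus_split: "finite A \<Longrightarrow> finite B \<Longrightarrow> finite (E_plus_split A B u a)"
  by (simp add: E_plus_split_def)

lemma E_plus_split_mono: "A \<subseteq> Ep \<Longrightarrow> B \<subseteq> Em \<Longrightarrow> E_plus_split A B u a \<subseteq> E_plus_split Ep Em u a"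
  by (auto simp: E_plus_split_def)

lemma split_weight_nonneg:
  assumes "\<forall>x\<in>A. 0 \<le> \<alpha> x" "\<forall>x\<in>B. 0 \<le> \<beta> x"
  shows "\<forall>x\<in>E_plus_split A B u a. 0 \<le> split_weight \<alpha> \<beta> u a x"
  using assms by (auto simp: E_plus_split_def split_weight_def H_plus_def H_minus_def)

lemma sum_split_weight:
  assumes "finite A" "finite B"
  shows "(\<Sum>x\<in>E_plus_split A B u a. split_weight \<alpha> \<beta> u a x * g x) =
    (\<Sum>x\<in>A \<inter> H_plus u a. \<bar>u \<bullet> x - a\<bar> * (\<alpha> x * g x))
      + (\<Sum>x\<in>B \<inter> H_minus u a. \<bar>u \<bullet> x - a\<bar> * (\<beta> x * g x))"
proof -
  have "(\<Sum>x\<in>E_plus_split A B u a. split_weight \<alpha> \<beta> u a x * g x) =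
    (\<Sum>x\<in>A \<inter> H_plus u a. split_weight \<alpha> \<beta> u a x * g x)
      + (\<Sum>x\<in>B \<inter> H_minus u a. split_weight \<alpha> \<beta> u a x * g x)"
    unfolding E_plus_split_def using assms
    by (intro sum.union_disjoint) (auto simp: H_plus_def H_minus_def)
  also have "\<dots> = (\<Sum>x\<in>A \<inter> H_plus u a. \<bar>u \<bullet> x - a\<bar> * (\<alpha> x * g x))
      + (\<Sum>x\<in>B \<inter> H_minus u a. \<bar>u \<bullet> x - a\<bar> * (\<beta> x * g x))"
    by (intro arg_cong2[where f = "(+)"] sum.cong)
      (auto simp: split_weight_def H_plus_def H_minus_def)
  finally show ?thesis .
qed

text \<open>
  Both sides of each moment equation for the weights \<open>\<alpha> l\<close> and \<open>\<beta> l\<close> are differences of a part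
  over \<open>l > 0\<close> and a part over \<open>l < 0\<close>; exchanging the subtracted parts gives the claim.
\<close>

lemma equal_moments_split:
  assumes "equal_moments (Suc k) A \<alpha> B \<beta>" "finite A" "finite B"
  shows "equal_moments k (E_plus_split A B u a) (split_weight \<alpha> \<beta> u a)
    (E_plus_split B A u a) (split_weight \<beta> \<alpha> u a)"
  unfolding equal_moments_def
proof (intro allI impI)
  fix e :: "nat ^ 'a"
  assume "total_degree e \<le> k"
  then have "(\<Sum>x\<in>A. (u \<bullet> x - a) * (\<alpha> x * monomial e x)) =
      (\<Sum>x\<in>B. (u \<bullet> x - a) * (\<beta> x * monomial e x))"
    using equal_moments_times_affine[OF assms(1), of u a]
    by (simp add: equal_moments_def mult_ac)
  then show "(\<Sum>x\<in>E_plus_split A B u a. split_weight \<alpha> \<beta> u a x * monomial e x) =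
      (\<Sum>x\<in>E_plus_split B A u a. split_weight \<beta> \<alpha> u a x * monomial e x)"
    unfolding sum_split_weight[OF assms(2,3)] sum_split_weight[OF assms(3,2)]
      sum_split_by_hyperplane[OF assms(2)] sum_split_by_hyperplane[OF assms(3)]
    by linarith
qed

section \<open>Degree reduction or point elimination\<close>

lemma weight_vanishes_off_hyperplane:
  assumes "finite A" "finite B" "\<forall>x\<in>A. 0 \<le> \<alpha> x" "\<forall>x\<in>B. 0 \<le> \<beta> x"
    and "sum (split_weight \<alpha> \<beta> u a) (E_plus_split A B u a) = 0"
    and "sum (split_weight \<beta> \<alpha> u a) (E_plus_split B A u a) = 0"
  shows "\<forall>x\<in>A - H_zero u a. \<alpha> x = 0"
proof
  have vanish: "\<forall>x\<in>E_plus_split A B u a. split_weight \<alpha> \<beta> u a x = 0"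
    "\<forall>x\<in>E_plus_split B A u a. split_weight \<beta> \<alpha> u a x = 0"
    using assms split_weight_nonneg[of A \<alpha> B \<beta> u a] split_weight_nonneg[of B \<beta> A \<alpha> u a]
    by (simp_all add: sum_nonneg_eq_0_iff finite_E_plus_split)
  fix x
  assume x: "x \<in> A - H_zero u a"
  then consider "u \<bullet> x - a > 0" | "u \<bullet> x - a < 0"
    by (force simp: H_zero_def)
  then show "\<alpha> x = 0"
  proof cases
    case 1
    with x have "x \<in> E_plus_split A B u a"
      by (auto simp: E_plus_split_def H_plus_def)
    with vanish(1) have "split_weight \<alpha> \<beta> u a x = 0"
      by blast
    with 1 show ?thesis
      by (simp add: split_weight_def H_plus_def)
  next
    case 2
    with x have "x \<in> E_plus_split B A u a"
      by (auto simp: E_plus_split_def H_minus_def)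
    with vanish(2) have "split_weight \<beta> \<alpha> u a x = 0"
      by blast
    with 2 show ?thesis
      by (simp add: split_weight_def H_plus_def)
  qed
qed

lemma degree_reduction_or_point_elimination:
  fixes Ep Em :: "(real ^ 'd) set"
  assumes "convex hull (monomial_vector (Suc k) ` Ep) \<inter> convex hull (monomial_vector (Suc k) ` Em) \<noteq> {}"
  shows "convex hull (monomial_vector k ` E_plus_split Ep Em u a) \<inter>
         convex hull (monomial_vector k ` E_minus_split Ep Em u a) \<noteq> {} \<or>
       convex hull (monomial_vector (Suc k) ` (Ep \<inter> H_zero u a)) \<inter>
         convex hull (monomial_vector (Suc k) ` (Em \<inter> H_zero u a)) \<noteq> {}"
proof -
  obtain A \<alpha> B \<beta> where A: "finite A" "A \<subseteq> Ep" "\<forall>x\<in>A. 0 \<le> \<alpha> x" "0 < sum \<alpha> A"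
    and B: "finite B" "B \<subseteq> Em" "\<forall>x\<in>B. 0 \<le> \<beta> x" and eq: "equal_moments (Suc k) A \<alpha> B \<beta>"
    using assms unfolding convex_hulls_meet_iff_equal_moments by blast
  let ?C = "E_plus_split A B u a" and ?\<gamma> = "split_weight \<alpha> \<beta> u a"
  let ?D = "E_plus_split B A u a" and ?\<delta> = "split_weight \<beta> \<alpha> u a"
  have split: "equal_moments k ?C ?\<gamma> ?D ?\<delta>"
    by (rule equal_moments_split[OF eq A(1) B(1)])
  have nonneg: "\<forall>x\<in>?C. 0 \<le> ?\<gamma> x" "\<forall>x\<in>?D. 0 \<le> ?\<delta> x"
    by (rule split_weight_nonneg; fact)+
  show ?thesis
  proof (cases "sum ?\<gamma> ?C = 0")
    case False
    then have "0 < sum ?\<gamma> ?C"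
      using nonneg(1) by (simp add: order_less_le sum_nonneg)
    moreover have "finite ?C" "finite ?D"
      using A(1) B(1) by (simp_all add: finite_E_plus_split)
    moreover have "?C \<subseteq> E_plus_split Ep Em u a" "?D \<subseteq> E_minus_split Ep Em u a"
      using A(2) B(2) by (simp_all add: E_minus_split_swap E_plus_split_mono)
    ultimately show ?thesis
      unfolding convex_hulls_meet_iff_equal_moments[of k] using nonneg split by blast
  next
    case True
    moreover from True have "sum ?\<delta> ?D = 0"
      using equal_moments_imp_equal_mass[OF split] by simp
    ultimately have zero: "\<forall>x\<in>A - H_zero u a. \<alpha> x = 0" "\<forall>x\<in>B - H_zero u a. \<beta> x = 0"
      using weight_vanishes_off_hyperplane[of A B \<alpha> \<beta> u a]
        weight_vanishes_off_hyperplane[of B A \<beta> \<alpha> u a] A B by blast+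
    have restrict: "(\<Sum>x\<in>A \<inter> H_zero u a. \<alpha> x * g x) = (\<Sum>x\<in>A. \<alpha> x * g x)"
      "(\<Sum>x\<in>B \<inter> H_zero u a. \<beta> x * g x) = (\<Sum>x\<in>B. \<beta> x * g x)" for g
      using zero A(1) B(1) by (auto intro!: sum.mono_neutral_left)
    have "equal_moments (Suc k) (A \<inter> H_zero u a) \<alpha> (B \<inter> H_zero u a) \<beta>"
      using eq by (simp add: equal_moments_def restrict)
    moreover have "0 < sum \<alpha> (A \<inter> H_zero u a)"
      using A(4) restrict(1)[of "\<lambda>_. 1"] by simp
    moreover have "finite (A \<inter> H_zero u a)" "finite (B \<inter> H_zero u a)"
      "A \<inter> H_zero u a \<subseteq> Ep \<inter> H_zero u a" "B \<inter> H_zero u a \<subseteq> Em \<inter> H_zero u a"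
      "\<forall>x\<in>A \<inter> H_zero u a. 0 \<le> \<alpha> x" "\<forall>x\<in>B \<inter> H_zero u a. 0 \<le> \<beta> x"
      using A B by auto
    ultimately show ?thesis
      unfolding convex_hulls_meet_iff_equal_moments[of "Suc k"] by blast
  qed
qed

theorem theorem4p1:
  fixes Q :: "(real ^ 'd) set"
    and f L :: "real ^ 'd \<Rightarrow> real"
    and m :: nat
  assumes "m \<ge> 1"
    and "(\<exists>p q. Q = cbox p q) \<or> finite Q"
    and "continuous_on Q f"
    and "polynomial_of_degree_le m L"
  defines "Ep \<equiv> E_plus Q f L"
    and "Em \<equiv> E_minus Q f L"
  shows "convex hull (monomial_vector m ` Ep) \<inter> convex hull (monomial_vector m ` Em) \<noteq> {} \<longleftrightarrow>
    (\<forall>u a.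
       convex hull (monomial_vector (m - 1) ` E_plus_split Ep Em u a) \<inter>
         convex hull (monomial_vector (m - 1) ` E_minus_split Ep Em u a) \<noteq> {} \<or>
       convex hull (monomial_vector m ` (Ep \<inter> H_zero u a)) \<inter>
         convex hull (monomial_vector m ` (Em \<inter> H_zero u a)) \<noteq> {})"
    (is "?meet \<longleftrightarrow> (\<forall>u a. ?reduction u a \<or> ?elimination u a)")
proof
  assume ?meet
  moreover obtain k where "m = Suc k"
    using assms(1) by (cases m) auto
  ultimately show "\<forall>u a. ?reduction u a \<or> ?elimination u a"
    using degree_reduction_or_point_elimination[of k Ep Em] by auto
next
  assume "\<forall>u a. ?reduction u a \<or> ?elimination u a"
  then have "?reduction 0 0 \<or> ?elimination 0 0"
    by blast
  moreover have "\<not> ?reduction 0 0"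
    by (simp add: E_plus_split_def E_minus_split_def H_plus_def H_minus_def)
  ultimately show ?meet
    by (simp add: H_zero_def)
qed

end
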